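(* Every integral solution $(x,y)\in\mathbb Z^2$ of $X^2-\Delta Y^2=4$ gives rise to an integral solution of one of the equations $\mathcal T_a: ar^2-bs^2=4$, where $a,b$ are integers with $ab=\Delta$ and $a$ is squarefree; namely there are such $a,b$ and integers $r,s$ with $ar^2-bs^2=4$, $x=ar^2-2$ and $y=rs$. Conversely, for any integers $a,b$ with $ab=\Delta$, any integral solution $(r,s)$ of $ar^2-bs^2=4$ gives an integral solution $(x,y)=(ar^2-2,\,rs)$ of $X^2-\Delta Y^2=4$.
   Context: Let $d$ be a squarefree integer with $d\neq 1$, and put $\Delta=d$ if $d\equiv 1\pmod 4$ and $\Delta=4d$ if $d\equiv 2,3\pmod 4$. *)

theory Defs
  imports "HOL-Computational_Algebra.Squarefree" "HOL-Number_Theory.Cong"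
begin

(* Meant for squarefree d, for which d is not divisible by 4,
   so that the second case is exactly d = 2, 3 (mod 4). *)
definition quad_disc :: "int \<Rightarrow> int" where
  "quad_disc d = (if [d = 1] (mod 4) then d else 4 * d)"

end

theory Submission imports Defs begin

text \<open>
  The equation factors as \<open>(x + 2) (x - 2) = \<Delta> y\<^sup>2\<close>. After dividing out the powers of
  2 common to the two factors, one has coprime \<open>u\<close>, \<open>v\<close> with \<open>u v = d z\<^sup>2\<close>. With
  \<open>a = \<plusminus>gcd u d\<close> and \<open>b = d / a\<close> the cofactors \<open>u / a\<close> and \<open>v / b\<close> are integers, coprime, and
  have product \<open>z\<^sup>2\<close>, hence are squares for the right choice of the sign.
\<close>

text \<open>Squaring commutes with gcd, and \<open>u\<close> can be pulled out of
  \<open>gcd (u * u) (u * v)\<close>. No prime factorization is needed, and \<open>u = 0\<close> is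
  covered as well.\<close>

lemma abs_eq_gcd_square_if_coprime_mult_eq_square:
  fixes u v z :: int
  assumes "coprime u v" and "u * v = z\<^sup>2"
  shows "\<bar>u\<bar> = (gcd u z)\<^sup>2"
proof -
  have "(gcd u z)\<^sup>2 = gcd (u\<^sup>2) (z\<^sup>2)"
    by simp
  also have "\<dots> = gcd (u * u) (u * v)"
    by (simp only: assms(2) power2_eq_square)
  also have "\<dots> = \<bar>u\<bar> * gcd u v"
    by (simp add: gcd_mult_left abs_mult)
  finally show ?thesis
    using assms(1) by simp
qed

text \<open>Since \<open>u * v\<close> is a square, \<open>u\<close> and \<open>v\<close> can share
  one sign \<open>e\<close>. Writing this as \<open>e * e = 1\<close> lets a later product of two
  factors absorb \<open>e\<close> twice.\<close>

lemma coprime_mult_eq_square_cases: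
  fixes u v z :: int
  assumes "coprime u v" and "u * v = z\<^sup>2"
  obtains e r s :: int where "e * e = 1" "u = e * r\<^sup>2" "v = e * s\<^sup>2" "z = r * s"
proof -
  define r where "r = gcd u z"
  define s where "s = gcd v z"
  have u: "\<bar>u\<bar> = r\<^sup>2"
    unfolding r_def by (rule abs_eq_gcd_square_if_coprime_mult_eq_square[OF assms])
  have v: "\<bar>v\<bar> = s\<^sup>2"
    unfolding s_def using assms
    by (intro abs_eq_gcd_square_if_coprime_mult_eq_square[of v u])
      (simp_all add: coprime_commute mult.commute)
  have "z\<^sup>2 = \<bar>u\<bar> * \<bar>v\<bar>"
    using assms(2) by (simp flip: abs_mult)
  then have "z\<^sup>2 = (r * s)\<^sup>2"
    by (simp add: u v power_mult_distrib)
  \<comment> \<open>\<open>s'\<close> is \<open>s\<close> or \<open>-s\<close>, chosen so that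
    \<open>z = r * s'\<close> holds exactly and not only up to sign.\<close>
  then obtain s' where s': "z = r * s'" "s'\<^sup>2 = s\<^sup>2"
    by (metis mult_minus_right power2_eq_iff)
  have "u * v \<ge> 0"
    using assms(2) by simp
  then consider "u \<ge> 0" "v \<ge> 0" | "u \<le> 0" "v \<le> 0"
    by (auto simp: zero_le_mult_iff)
  then show ?thesis
  proof cases
    case 1
    then show ?thesis using u v s' that[of 1 r s'] by simp
  next
    case 2
    then show ?thesis using u v s' that[of "-1" r s'] by simp
  qed
qed

lemma coprime_mult_eq_mult_square:
  fixes d u v z :: int
  assumes "d \<noteq> 0" and "coprime u v" and "u * v = d * z\<^sup>2"
  obtains a b r s where "a * b = d" "u = a * r\<^sup>2" "v = b * s\<^sup>2" "z = r * s"
proof -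
  define g where "g = gcd u d"
  have "g \<noteq> 0"
    using assms(1) by (simp add: g_def)
  obtain u' where u': "u = g * u'"
    using g_def by (metis dvdE gcd_dvd1)
  obtain h where h: "d = g * h"
    using g_def by (metis dvdE gcd_dvd2)
  \<comment> \<open>Once \<open>g\<close> is divided out, \<open>u'\<close> is coprime to
    \<open>h\<close>, so all of \<open>h\<close> must divide \<open>v\<close>.\<close>
  have "coprime (u div g) (d div g)"
    unfolding g_def using assms(1) by (intro div_gcd_coprime) simp
  then have "coprime u' h"
    using \<open>g \<noteq> 0\<close> by (simp add: u' h)
  have eq: "u' * v = h * z\<^sup>2"
    using assms(3) \<open>g \<noteq> 0\<close> by (simp add: u' h mult.assoc)
  then have "h dvd u' * v"
    by simp
  then have "h dvd v"
    using \<open>coprime u' h\<close> by (simp add: coprime_commute coprime_dvd_mult_right_iff)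
  then obtain v' where v': "v = h * v'" ..
  have "h \<noteq> 0"
    using assms(1) h by auto
  then have "u' * v' = z\<^sup>2"
    using eq by (simp add: v' mult.left_commute)
  moreover have "coprime u' v'"
    using assms(2) by (simp add: u' v')
  ultimately obtain e r s where
    e: "e * e = 1" and "u' = e * r\<^sup>2" "v' = e * s\<^sup>2" "z = r * s"
    by (elim coprime_mult_eq_square_cases)
  moreover have "(g * e) * (h * e) = d"
    using e h by (metis mult.assoc mult.left_commute mult.right_neutral)
  ultimately show ?thesis
    using that[of "g * e" "h * e" r s] by (simp add: u' v' mult.assoc)
qed

lemma squarefree_not_4_dvd:
  fixes d :: int
  assumes "squarefree d"
  shows "\<not> 4 dvd d"
  using squarefreeD[OF assms, of 2] by auto

text \<open>With \<open>x = 2 * k + 1\<close>, the product \<open>(x + 1) * (x - 1)\<close> is four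
  times that of the coprime integers \<open>k + 1\<close> and \<open>k\<close>. As 4 does not divide
  \<open>d\<close>, \<open>y\<close> is even and the 4 cancels.\<close>

lemma odd_pell_solution_factors:
  fixes d x y :: int
  assumes "squarefree d" and "odd x" and eq: "x\<^sup>2 - d * y\<^sup>2 = 1"
  obtains a b r s
  where "a * b = d" "x + 1 = 2 * (a * r\<^sup>2)" "x - 1 = 2 * (b * s\<^sup>2)" "y = 2 * (r * s)"
proof -
  obtain k where k: "x = 2 * k + 1"
    using \<open>odd x\<close> by (elim oddE)
  have *: "d * y\<^sup>2 = 4 * ((k + 1) * k)"
    using eq by (simp add: k power2_eq_square algebra_simps)
  have "even y"
  proof (rule ccontr)
    assume "odd y"
    then have "coprime 4 (y\<^sup>2)"
      using coprime_power_left_iff[of 2 2 y] by simp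
    moreover have "4 dvd d * y\<^sup>2"
      unfolding * by simp
    ultimately have "4 dvd d"
      by (simp add: coprime_dvd_mult_left_iff)
    then show False
      using squarefree_not_4_dvd[OF assms(1)] by simp
  qed
  then obtain z where z: "y = 2 * z" ..
  have "(k + 1) * k = d * z\<^sup>2"
    using * by (simp add: z power_mult_distrib)
  moreover have "coprime (k + 1) k"
    by simp
  moreover have "d \<noteq> 0"
    using assms(1) by auto
  ultimately obtain a b r s where "a * b = d" "k + 1 = a * r\<^sup>2" "k = b * s\<^sup>2" "z = r * s"
    using coprime_mult_eq_mult_square by metis
  then show ?thesis
    using that[of a b r s] by (simp add: k z)
qed

text \<open>A common divisor is odd and divides \<open>2 * c\<close>, hence 4. The cases used are
  \<open>c = 2\<close> and \<open>c = 1\<close>.\<close>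

lemma coprime_add_diff_if_odd:
  fixes x c :: int
  assumes "odd (x + c)" and "2 * c dvd 4"
  shows "coprime (x + c) (x - c)"
proof (rule coprimeI)
  fix g assume g: "g dvd x + c" "g dvd x - c"
  then have "g dvd (x + c) - (x - c)"
    by (rule dvd_diff)
  then have "g dvd 2\<^sup>2"
    using assms(2) by (auto elim: dvd_trans)
  moreover have "coprime g (2\<^sup>2)"
  proof -
    have "odd g"
      using g(1) assms(1) dvd_trans by blast
    then show ?thesis
      using coprime_power_right_iff[of g 2 2] by simp
  qed
  ultimately show "is_unit g"
    by (metis coprime_absorb_left)
qed

lemma squarefree_left_factor:
  fixes a b d :: int
  assumes "squarefree d" and "a * b = d"
  shows "squarefree a"
  using assms squarefree_multD(1) by blast

text \<open>The cases differ in the power of 2 removed before the factors are coprime, and in how it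
  is put back into \<open>a\<close>, \<open>b\<close>, \<open>r\<close>, \<open>s\<close> so that
  \<open>a\<close> stays squarefree.\<close>

lemma norm_4_solution_factors:
  fixes d x y :: int
  assumes sqf: "squarefree d" and eq: "x\<^sup>2 - quad_disc d * y\<^sup>2 = 4"
  obtains a b r s where "a * b = quad_disc d" "squarefree a"
    "x + 2 = a * r\<^sup>2" "x - 2 = b * s\<^sup>2" "y = r * s"
proof (cases "[d = 1] (mod 4)")
  case True
  then have Delta: "quad_disc d = d"
    by (simp add: quad_disc_def)
  have "d mod 4 = 1"
    using True by (simp add: cong_def)
  then have "odd d"
    by presburger
  have "d \<noteq> 0"
    using sqf by auto
  show ?thesis
  proof (cases "odd x")
    case True
    then have "coprime (x + 2) (x - 2)"
      by (intro coprime_add_diff_if_odd) simp_all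
    moreover have "(x + 2) * (x - 2) = d * y\<^sup>2"
      using eq by (simp add: Delta power2_eq_square algebra_simps)
    ultimately obtain a b r s where
      "a * b = d" "x + 2 = a * r\<^sup>2" "x - 2 = b * s\<^sup>2" "y = r * s"
      using coprime_mult_eq_mult_square \<open>d \<noteq> 0\<close> by metis
    then show ?thesis
      using that[of a b r s] squarefree_left_factor[OF sqf] by (simp add: Delta)
  next
    case False
    then obtain k where k: "x = 2 * k" by auto
    have "even (d * y\<^sup>2)"
    proof -
      have "d * y\<^sup>2 = 2 * (2 * k\<^sup>2 - 2)"
        using eq by (simp add: Delta k power_mult_distrib)
      then show ?thesis by simp
    qed
    then obtain z where z: "y = 2 * z"
      using \<open>odd d\<close> by auto
    have kz: "k\<^sup>2 - d * z\<^sup>2 = 1"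
      using eq by (simp add: Delta k z power_mult_distrib)
    \<comment> \<open>If \<open>k\<close> were even, \<open>z\<close> would be odd, and
      \<open>d = 1\<close> modulo 4 would make the left side of \<open>kz\<close> congruent to -1
      modulo 4.\<close>
    have "odd k"
    proof
      assume "even k"
      have "d * z\<^sup>2 = k\<^sup>2 - 1"
        using kz by simp
      then have "odd (d * z\<^sup>2)"
        using \<open>even k\<close> by (simp del: even_mult_iff)
      then obtain m where m: "z = 2 * m + 1"
        by (auto elim: oddE)
      obtain l where l: "k = 2 * l" using \<open>even k\<close> ..
      obtain n where n: "d = 4 * n + 1"
        using \<open>d mod 4 = 1\<close> by (metis mult_div_mod_eq)
      have "4 * (l\<^sup>2 - n * z\<^sup>2 - m\<^sup>2 - m) = 2"
        using kz by (simp add: l n m power2_eq_square algebra_simps)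
      then show False by presburger
    qed
    then obtain a b r s where
      "a * b = d" "k + 1 = 2 * (a * r\<^sup>2)" "k - 1 = 2 * (b * s\<^sup>2)" "z = 2 * (r * s)"
      using odd_pell_solution_factors sqf kz by metis
    then show ?thesis
      \<comment> \<open>Here \<open>x + 2 = 4 * (a * r\<^sup>2)\<close> and
        \<open>x - 2 = 4 * (b * s\<^sup>2)\<close>; both 4s go into the squares, as
        \<open>a * b\<close> must remain \<open>d\<close>.\<close>
      using that[of a b "2 * r" "2 * s"] squarefree_left_factor[OF sqf]
      by (simp add: Delta k z power_mult_distrib)
  qed
next
  case False
  then have Delta: "quad_disc d = 4 * d"
    by (simp add: quad_disc_def)
  have "d \<noteq> 0"
    using sqf by auto
  have "x\<^sup>2 = 2 * (2 + 2 * (d * y\<^sup>2))"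
    using eq by (simp add: Delta)
  then have "even (x\<^sup>2)"
    by simp
  then obtain k where k: "x = 2 * k"
    by auto
  have ky: "k\<^sup>2 - d * y\<^sup>2 = 1"
    using eq by (simp add: Delta k power_mult_distrib)
  show ?thesis
  proof (cases "odd k")
    case True
    then obtain a b r s where
      "a * b = d" "k + 1 = 2 * (a * r\<^sup>2)" "k - 1 = 2 * (b * s\<^sup>2)" "y = 2 * (r * s)"
      using odd_pell_solution_factors sqf ky by metis
    then show ?thesis
      \<comment> \<open>Now the product must be \<open>4 * d\<close>. The extra 4 goes to
        \<open>b\<close>, since it would spoil squarefreeness of \<open>a\<close>.\<close>
      using that[of a "4 * b" "2 * r" s] squarefree_left_factor[OF sqf]
      by (simp add: Delta k power_mult_distrib)
  next
    case False
    have "d * y\<^sup>2 = k\<^sup>2 - 1"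
      using ky by simp
    then have "odd (d * y\<^sup>2)"
      using False by (simp del: even_mult_iff)
    then have "odd d"
      by simp
    have "coprime (k + 1) (k - 1)"
      using False by (intro coprime_add_diff_if_odd) simp_all
    moreover have "(k + 1) * (k - 1) = d * y\<^sup>2"
      using ky by (simp add: power2_eq_square algebra_simps)
    ultimately obtain a b r s where
      ab: "a * b = d" "k + 1 = a * r\<^sup>2" "k - 1 = b * s\<^sup>2" "y = r * s"
      using coprime_mult_eq_mult_square \<open>d \<noteq> 0\<close> by metis
    \<comment> \<open>Here \<open>x + 2 = 2 * (k + 1)\<close> and
      \<open>x - 2 = 2 * (k - 1)\<close>, so \<open>a\<close> and \<open>b\<close> each receive a 2.
      That \<open>a\<close> is odd keeps \<open>2 * a\<close> squarefree.\<close>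
    have "odd a"
      using ab(1) \<open>odd d\<close> by auto
    then have "squarefree (2 * a)"
      using squarefree_left_factor[OF sqf ab(1)]
      by (intro squarefree_mult_coprime) (auto intro: squarefree_prime)
    then show ?thesis
      using that[of "2 * a" "2 * b" r s] ab by (simp add: Delta k)
  qed
qed

theorem theorem3p1:
  fixes d :: int
  assumes "squarefree d" and "d \<noteq> 1"
  shows "(\<forall>x y :: int. x\<^sup>2 - quad_disc d * y\<^sup>2 = 4 \<longrightarrow>
            (\<exists>a b r s :: int. a * b = quad_disc d \<and> squarefree a \<and>
               a * r\<^sup>2 - b * s\<^sup>2 = 4 \<and> x = a * r\<^sup>2 - 2 \<and> y = r * s)) \<and>
         (\<forall>a b r s :: int. a * b = quad_disc d \<longrightarrow> a * r\<^sup>2 - b * s\<^sup>2 = 4 \<longrightarrow>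
            (a * r\<^sup>2 - 2)\<^sup>2 - quad_disc d * (r * s)\<^sup>2 = 4)"
proof (intro conjI allI impI)
  fix x y :: int
  assume "x\<^sup>2 - quad_disc d * y\<^sup>2 = 4"
  then obtain a b r s where
    ab: "a * b = quad_disc d" "squarefree a" and
    eqs: "x + 2 = a * r\<^sup>2" "x - 2 = b * s\<^sup>2" and "y = r * s"
    using norm_4_solution_factors[OF assms(1)] by metis
  moreover have "a * r\<^sup>2 - b * s\<^sup>2 = 4" "x = a * r\<^sup>2 - 2"
    using eqs by linarith+
  ultimately show "\<exists>a b r s :: int. a * b = quad_disc d \<and> squarefree a \<and>
      a * r\<^sup>2 - b * s\<^sup>2 = 4 \<and> x = a * r\<^sup>2 - 2 \<and> y = r * s"
    by blast
next
  fix a b r s :: int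
  assume ab: "a * b = quad_disc d" and "a * r\<^sup>2 - b * s\<^sup>2 = 4"
  then have bs: "b * s\<^sup>2 = a * r\<^sup>2 - 4"
    by simp
  \<comment> \<open>With \<open>t = a * r\<^sup>2\<close> the right side is
    \<open>t * (t - 4)\<close>, and completing the square gives
    \<open>(t - 2)\<^sup>2 - 4\<close>.\<close>
  have "quad_disc d * (r * s)\<^sup>2 = (a * r\<^sup>2) * (b * s\<^sup>2)"
    by (simp add: power_mult_distrib flip: ab)
  also have "\<dots> = (a * r\<^sup>2 - 2)\<^sup>2 - 4"
    unfolding bs by (simp add: power2_eq_square algebra_simps)
  finally show "(a * r\<^sup>2 - 2)\<^sup>2 - quad_disc d * (r * s)\<^sup>2 = 4"
    by simp
qed

end
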